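(* The sets of patterns $\{112,2312\}$, $\{121,1223\}$ and $\{121,2213\}$ are pairwise $m$-equivalent, that is, $\{112,2312\}\sim\{121,1223\}\sim\{121,2213\}$.
   Context: A (finite, reduced) multiset is $S=1^{a_1}2^{a_2}\cdots k^{a_k}$ with $k\ge 1$ and all $a_i\ge 1$, meaning that $i$ occurs with multiplicity $a_i$. A multipermutation of $S$ is a word having exactly $a_i$ occurrences of each letter $i\in[k]=\{1,\dots,k\}$ and no other letters. A word $\pi=\pi_1\cdots\pi_n$ contains a pattern (word) $\rho=\rho_1\cdots\rho_\ell$ if there are indices $i(1)<\cdots<i(\ell)$ such that for all $a,b\in[\ell]$: $\pi_{i(a)}<\pi_{i(b)}$ iff $\rho_a<\rho_b$, and $\pi_{i(a)}>\pi_{i(b)}$ iff $\rho_a>\rho_b$; otherwise $\pi$ avoids $\rho$. For a set $P$ of patterns, $\mathrm{av}(S;P)$ is the number of multipermutations of $S$ that avoid every pattern in $P$. Two sets of patterns $P,Q$ are $m$-equivalent, written here $P\sim Q$, if $\mathrm{av}(S;P)=\mathrm{av}(S;Q)$ for every multiset $S$. *)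

theory Defs
  imports "HOL-Combinatorics.Multiset_Permutations"
begin

text \<open>Words are lists of natural numbers, with letters starting at 1 and positions at 0.
  A finite reduced multiset $1^{a_1} \cdots k^{a_k}$ with all $a_i \geq 1$ is a multiset
  whose support is exactly \<open>{1..k}\<close>; its multipermutations are the members of
  \<^const>\<open>permutations_of_multiset\<close>.\<close>

definition reduced_mset :: "nat multiset \<Rightarrow> bool" where
  "reduced_mset S \<longleftrightarrow> (\<exists>k\<ge>1. set_mset S = {1..k})"

definition contains_pattern :: "nat list \<Rightarrow> nat list \<Rightarrow> bool" where
  "contains_pattern w p \<longleftrightarrow>
    (\<exists>i :: nat \<Rightarrow> nat.
      strict_mono_on {..<length p} i \<and>
      (\<forall>a<length p. i a < length w) \<and>
      (\<forall>a<length p. \<forall>b<length p.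
        (w ! i a < w ! i b \<longleftrightarrow> p ! a < p ! b) \<and>
        (w ! i a > w ! i b \<longleftrightarrow> p ! a > p ! b)))"

definition avoids_pattern :: "nat list \<Rightarrow> nat list \<Rightarrow> bool" where
  "avoids_pattern w p \<longleftrightarrow> \<not> contains_pattern w p"

definition av :: "nat multiset \<Rightarrow> nat list set \<Rightarrow> nat" where
  "av S P = card {w \<in> permutations_of_multiset S. \<forall>p\<in>P. avoids_pattern w p}"

definition m_equivalent :: "nat list set \<Rightarrow> nat list set \<Rightarrow> bool" where
  "m_equivalent P Q \<longleftrightarrow> (\<forall>S. reduced_mset S \<longrightarrow> av S P = av S Q)"

end

theory Submission
  imports Defs "HOL-Library.Sublist"
begin

text \<open>Build a multipermutation by inserting all \<open>a\<close> copies of a new smallest letter \<open>x\<close> at once.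
  Avoiding 121 forces the copies to form one block; avoiding 112 forces all but the first copy to the
  end of the word. In each case the insertion is determined by a position (a site), and the
  length-four pattern decides which sites are allowed. A word with \<open>n\<close> allowed sites has \<open>n\<close>
  children, and for all three pattern sets their numbers of allowed sites are the same: \<open>n + 1\<close> for
  every child if \<open>a = 1\<close>, and \<open>n + a, 3, 4, \<dots>, n + 1\<close> (with \<open>n + a\<close> coming from insertion at the
  end) if \<open>a \<ge> 2\<close>. So the three generating trees coincide.\<close>

section \<open>Pattern containment in terms of subsequences\<close>

text \<open>The lower bound \<open>n\<close> serves the induction: once the first index
  \<open>i\<close> is used, the remaining indices live in \<open>drop (Suc i) w\<close>.\<close>

lemma subseq_map_nth_drop:
  assumes "sorted_wrt (<) is" "\<forall>i\<in>set is. n \<le> i \<and> i < length w"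
  shows "subseq (map ((!) w) is) (drop n w)"
  using assms
proof (induction "is" arbitrary: n)
  case (Cons i js)
  have "subseq (map ((!) w) js) (drop (Suc i) w)"
    using Cons.prems by (intro Cons.IH) auto
  hence "subseq (map ((!) w) (i # js)) (drop i w)"
    using Cons.prems by (simp add: Cons_nth_drop_Suc[symmetric])
  moreover have "drop i w = drop (i - n) (drop n w)"
    using Cons.prems by simp
  ultimately show ?case
    by (metis append_take_drop_id subseq_drop_many)
qed simp

text \<open>Bridge between the inductive relation \<open>subseq\<close> and the increasing index
  maps that occur in \<open>contains_pattern_def\<close>.\<close>

lemma subseq_iff_strict_mono:
  "subseq q w \<longleftrightarrow> (\<exists>i. strict_mono_on {..<length q} i \<and>
     (\<forall>a<length q. i a < length w \<and> q ! a = w ! i a))" (is "_ \<longleftrightarrow> ?R q w")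
proof
  assume "subseq q w"
  thus "?R q w"
  proof induction
    case (list_emb_Nil ys)
    show ?case by (auto simp: strict_mono_on_def)
  next
    case (list_emb_Cons xs ys y)
    then obtain i where i: "strict_mono_on {..<length xs} i"
      "\<forall>a<length xs. i a < length ys \<and> xs ! a = ys ! i a" by blast
    show ?case
      using i by (intro exI[of _ "\<lambda>a. Suc (i a)"]) (auto simp: strict_mono_on_def)
  next
    case (list_emb_Cons2 x y xs ys)
    then obtain i where i: "strict_mono_on {..<length xs} i"
      "\<forall>a<length xs. i a < length ys \<and> xs ! a = ys ! i a" by blast
    \<comment> \<open>The matched heads take position 0 on both sides; the embedding of the tails is
      shifted by one in argument and value.\<close>
    show ?case
      using i list_emb_Cons2.hyps
      by (intro exI[of _ "\<lambda>a. case a of 0 \<Rightarrow> 0 | Suc b \<Rightarrow> Suc (i b)"])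
        (auto simp: strict_mono_on_def split: nat.splits)
  qed
next
  assume "?R q w"
  then obtain i where i: "strict_mono_on {..<length q} i"
    "\<forall>a<length q. i a < length w \<and> q ! a = w ! i a" by blast
  have "subseq (map ((!) w) (map i [0..<length q])) (drop 0 w)"
    using i by (intro subseq_map_nth_drop) (auto simp: sorted_wrt_map sorted_wrt_iff_nth_less strict_mono_on_def)
  moreover have "map ((!) w) (map i [0..<length q]) = q"
    using i by (intro nth_equalityI) auto
  ultimately show "subseq q w" by simp
qed

lemma contains_pattern_iff_subseq:
  "contains_pattern w p \<longleftrightarrow> (\<exists>q. subseq q w \<and> length q = length p \<and>
     (\<forall>a<length p. \<forall>b<length p.
        (q ! a < q ! b \<longleftrightarrow> p ! a < p ! b) \<and> (q ! a > q ! b \<longleftrightarrow> p ! a > p ! b)))"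
    (is "_ \<longleftrightarrow> (\<exists>q. ?R q)")
proof
  assume "contains_pattern w p"
  then obtain i where i: "strict_mono_on {..<length p} i" "\<forall>a<length p. i a < length w"
    "\<forall>a<length p. \<forall>b<length p.
        (w ! i a < w ! i b \<longleftrightarrow> p ! a < p ! b) \<and> (w ! i a > w ! i b \<longleftrightarrow> p ! a > p ! b)"
    unfolding contains_pattern_def by blast
  hence "?R (map (\<lambda>a. w ! i a) [0..<length p])"
    unfolding subseq_iff_strict_mono by auto
  thus "\<exists>q. ?R q" by blast
next
  assume "\<exists>q. ?R q"
  then obtain q where q: "?R q" by blast
  then obtain i where "strict_mono_on {..<length q} i"
    "\<forall>a<length q. i a < length w \<and> q ! a = w ! i a"
    unfolding subseq_iff_strict_mono by blast
  thus "contains_pattern w p"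
    using q unfolding contains_pattern_def by (intro exI[of _ i]) auto
qed

lemma ex_length_3: "(\<exists>q. P q \<and> length q = Suc (Suc (Suc 0)) \<and> Q q) \<longleftrightarrow> (\<exists>x y z. P [x,y,z] \<and> Q [x,y,z])"
  by (auto simp: length_Suc_conv)

lemma ex_length_4:
  "(\<exists>q. P q \<and> length q = Suc (Suc (Suc (Suc 0))) \<and> Q q) \<longleftrightarrow> (\<exists>x y z t. P [x,y,z,t] \<and> Q [x,y,z,t])"
  by (auto simp: length_Suc_conv)

text \<open>Two letters of which neither is smaller are equal, so order isomorphism to 112 leaves
  just two free letters \<open>x < y\<close>. The other patterns reduce in the same way.\<close>

lemma avoids_112: "avoids_pattern w [1,1,2] \<longleftrightarrow> (\<forall>x y. x < y \<longrightarrow> \<not> subseq [x,x,y] w)"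
  by (simp add: avoids_pattern_def contains_pattern_iff_subseq ex_length_3 All_less_Suc) 
    (metis linorder_neq_iff)

lemma avoids_121: "avoids_pattern w [1,2,1] \<longleftrightarrow> (\<forall>x y. x < y \<longrightarrow> \<not> subseq [x,y,x] w)"
  by (simp add: avoids_pattern_def contains_pattern_iff_subseq ex_length_3 All_less_Suc) 
    (metis linorder_neq_iff)

lemma avoids_1223:
  "avoids_pattern w [1,2,2,3] \<longleftrightarrow> (\<forall>x y z. x < y \<longrightarrow> y < z \<longrightarrow> \<not> subseq [x,y,y,z] w)"
  by (simp add: avoids_pattern_def contains_pattern_iff_subseq ex_length_4 All_less_Suc) 
    (metis linorder_neq_iff order.strict_trans)

lemma avoids_2213:
  "avoids_pattern w [2,2,1,3] \<longleftrightarrow> (\<forall>x y z. x < y \<longrightarrow> y < z \<longrightarrow> \<not> subseq [y,y,x,z] w)"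
  by (simp add: avoids_pattern_def contains_pattern_iff_subseq ex_length_4 All_less_Suc) 
    (metis linorder_neq_iff order.strict_trans)

lemma avoids_2312:
  "avoids_pattern w [2,3,1,2] \<longleftrightarrow> (\<forall>x y z. x < y \<longrightarrow> y < z \<longrightarrow> \<not> subseq [y,z,x,y] w)"
  by (simp add: avoids_pattern_def contains_pattern_iff_subseq ex_length_4 All_less_Suc) 
    (metis linorder_neq_iff order.strict_trans)

section \<open>Short subsequences of concatenations\<close>

lemma ex_append_eq_Cons:
  "(\<exists>q1 q2. a # q = q1 @ q2 \<and> P q1 q2) \<longleftrightarrow>
    P [] (a # q) \<or> (\<exists>q1 q2. q = q1 @ q2 \<and> P (a # q1) q2)"
  by (auto simp: Cons_eq_append_conv)

lemma ex_append_eq_Nil: "(\<exists>q1 q2. [] = q1 @ q2 \<and> P q1 q2) \<longleftrightarrow> P [] []"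
  by simp

text \<open>Rewriting with these rules runs through every cut of an explicit short word into two
  factors, so a subsequence of \<open>u @ v\<close> becomes a finite disjunction.\<close>

lemmas subseq_append_simps =
  subseq_append_iff ex_append_eq_Cons ex_append_eq_Nil subseq_singleton_left list_emb_Nil
  simp_thms

lemma subseq_pair_append:
  "subseq [p,q] (u @ v) \<longleftrightarrow>
    subseq [p,q] u \<or> p \<in> set u \<and> q \<in> set v \<or> subseq [p,q] v"
  unfolding subseq_append_simps by blast

lemma subseq_triple_append:
  "subseq [p,q,r] (u @ v) \<longleftrightarrow> subseq [p,q,r] u \<or> subseq [p,q] u \<and> r \<in> set v \<or>
    p \<in> set u \<and> subseq [q,r] v \<or> subseq [p,q,r] v"
  unfolding subseq_append_simps by blast

lemma subseq_quadruple_append: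
  "subseq [p,q,r,s] (u @ v) \<longleftrightarrow> subseq [p,q,r,s] u \<or> subseq [p,q,r] u \<and> s \<in> set v \<or>
    subseq [p,q] u \<and> subseq [r,s] v \<or> p \<in> set u \<and> subseq [q,r,s] v \<or> subseq [p,q,r,s] v"
  unfolding subseq_append_simps by blast

lemma set_subseq: "subseq u v \<Longrightarrow> set u \<subseteq> set v"
  by (auto simp: list_emb_set dest: list_emb_set)

lemma filter_neq_id: "x \<notin> set w \<Longrightarrow> filter (\<lambda>y. y \<noteq> x) w = w"
  by (metis (mono_tags, lifting) filter_True)

section \<open>Ranks in finite linearly ordered sets\<close>

text \<open>The rank is strictly increasing on \<open>A\<close>, hence injective, and its values lie
  in a set of the same size as \<open>A\<close>.\<close>

lemma bij_betw_rank:
  fixes A :: "'a::linorder set"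
  assumes "finite A"
  shows "bij_betw (\<lambda>p. card {q\<in>A. q \<le> p}) A {1..card A}" (is "bij_betw ?rank _ _")
proof -
  have mono: "card {q\<in>A. q \<le> p} < card {q\<in>A. q \<le> p'}" if "p' \<in> A" "p < p'" for p p'
    using that assms by (intro psubset_card_mono psubsetI) (auto dest!: equalityD2 subsetD[of _ _ p'])
  have inj: "inj_on (\<lambda>p. card {q\<in>A. q \<le> p}) A"
  proof (rule inj_onI)
    fix p p' assume "p \<in> A" "p' \<in> A" "?rank p = ?rank p'"
    thus "p = p'" using mono[of p p'] mono[of p' p] by (cases p p' rule: linorder_cases) auto
  qed
  have "card {q\<in>A. q \<le> p} \<in> {1..card A}" if "p \<in> A" for p
  proof -
    have "{q\<in>A. q \<le> p} \<noteq> {}" using that by blast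
    thus ?thesis using assms by (simp add: Suc_le_eq card_gt_0_iff card_mono)
  qed
  hence "(\<lambda>p. card {q\<in>A. q \<le> p}) ` A = {1..card A}"
    using inj by (intro card_subset_eq) (auto simp: card_image)
  thus ?thesis using inj by (simp add: bij_betw_def)
qed

lemma bij_betw_corank:
  fixes A :: "'a::linorder set"
  assumes "finite A"
  shows "bij_betw (\<lambda>p. card {q\<in>A. p \<le> q}) A {1..card A}" (is "bij_betw ?rank _ _")
proof -
  have mono: "card {q\<in>A. p' \<le> q} < card {q\<in>A. p \<le> q}" if "p \<in> A" "p < p'" for p p'
    using that assms by (intro psubset_card_mono psubsetI) (auto dest!: equalityD2 subsetD[of _ _ p])
  have inj: "inj_on (\<lambda>p. card {q\<in>A. p \<le> q}) A"
  proof (rule inj_onI)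
    fix p p' assume "p \<in> A" "p' \<in> A" "?rank p = ?rank p'"
    thus "p = p'" using mono[of p p'] mono[of p' p] by (cases p p' rule: linorder_cases) auto
  qed
  have "card {q\<in>A. p \<le> q} \<in> {1..card A}" if "p \<in> A" for p
  proof -
    have "{q\<in>A. p \<le> q} \<noteq> {}" using that by blast
    thus ?thesis using assms by (simp add: Suc_le_eq card_gt_0_iff card_mono)
  qed
  hence "(\<lambda>p. card {q\<in>A. p \<le> q}) ` A = {1..card A}"
    using inj by (intro card_subset_eq) (auto simp: card_image)
  thus ?thesis using inj by (simp add: bij_betw_def)
qed

text \<open>In the application \<open>A\<close> is the set of sites of a word, \<open>m\<close> is
  the end of the word, and the two functions count the sites of a child. Both equal a rank in
  \<open>A - {m}\<close>, counted from below or from above, plus 2.\<close>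

lemma bij_betw_rank_below_top:
  fixes A :: "nat set"
  assumes "finite A" "m \<in> A" "\<forall>q\<in>A. q \<le> m"
  shows "bij_betw (\<lambda>p. card {q\<in>A. q \<le> p} + 2) (A - {m}) {3..card A + 1}"
    and "bij_betw (\<lambda>p. card {q\<in>A. p \<le> q} + 1) (A - {m}) {3..card A + 1}"
proof -
  have card: "card (A - {m}) = card A - 1" "card A \<ge> 1"
    using assms by (auto simp: Suc_le_eq card_gt_0_iff)
  have shift: "bij_betw (\<lambda>n. n + 2) {1..card A - 1} {3..card A + 1}"
    using card(2) by (intro bij_betw_byWitness[of _ "\<lambda>n. n - 2"]) auto
  have "card {q\<in>A. q \<le> p} + 2 = card {q\<in>A - {m}. q \<le> p} + 2"
    if "p \<in> A - {m}" for p
  proof -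
    have "{q\<in>A. q \<le> p} = {q\<in>A - {m}. q \<le> p}" using that assms by force
    thus ?thesis by simp
  qed
  thus "bij_betw (\<lambda>p. card {q\<in>A. q \<le> p} + 2) (A - {m}) {3..card A + 1}"
    using bij_betw_trans[OF bij_betw_rank[of "A - {m}", unfolded card] shift] assms(1)
    by (subst bij_betw_cong) (auto simp: o_def)
  \<comment> \<open>Counted from above, \<open>m\<close> itself contributes one, so only 1 has to be
    added instead of 2.\<close>
  have "card {q\<in>A. p \<le> q} + 1 = card {q\<in>A - {m}. p \<le> q} + 2" if "p \<in> A - {m}" for p
  proof -
    have "{q\<in>A. p \<le> q} = insert m {q\<in>A - {m}. p \<le> q}" using that assms by auto
    thus ?thesis using assms(1) by simp
  qed
  thus "bij_betw (\<lambda>p. card {q\<in>A. p \<le> q} + 1) (A - {m}) {3..card A + 1}"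
    using bij_betw_trans[OF bij_betw_corank[of "A - {m}", unfolded card] shift] assms(1)
    by (subst bij_betw_cong) (auto simp: o_def)
qed

section \<open>Insertion schemes and their generating trees\<close>

text \<open>The parameter \<open>site u v\<close> says that a new smallest letter may be inserted between the two
  factors of \<open>u @ v\<close>.\<close>

definition sites :: "(nat list \<Rightarrow> nat list \<Rightarrow> bool) \<Rightarrow> nat list \<Rightarrow> nat set" where
  "sites site w = {p. p \<le> length w \<and> site (take p w) (drop p w)}"

lemma finite_sites [simp]: "finite (sites site w)"
  by (rule finite_subset[of _ "{..length w}"]) (auto simp: sites_def)

text \<open>The sum of \<open>f\<close> over the numbers of sites of the children of a word with \<open>n\<close> sites, and its
  iteration along the multiplicities, starting from the single site of the empty word.\<close>

definition child_sum :: "nat \<Rightarrow> (nat \<Rightarrow> nat) \<Rightarrow> nat \<Rightarrow> nat" where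
  "child_sum a f n = (if a = 1 then n * f (n + 1) else f (n + a) + sum f {3..n + 1})"

primrec tree_sum :: "nat list \<Rightarrow> (nat \<Rightarrow> nat) \<Rightarrow> nat" where
  "tree_sum [] f = f 1"
| "tree_sum (a # as) f = tree_sum as (child_sum a f)"

text \<open>The parameter \<open>ins x a u v\<close> inserts \<open>a\<close> copies of
  \<open>x\<close> at the cut between \<open>u\<close> and \<open>v\<close>; by
  \<open>ins_prefix\<close> the cut can be read off as the position of the first \<open>x\<close>.
  The two alternatives in \<open>site_filter\<close> correspond to a single copy of \<open>x\<close>
  and to copies placed at the end only; in both cases the sites of a child are controlled by those
  of its parent. The remaining children, with several copies and an inner cut, are left to
  \<open>inner_ranks\<close>.\<close>

locale insertion_scheme =
  fixes good :: "nat list \<Rightarrow> bool"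
    and site :: "nat list \<Rightarrow> nat list \<Rightarrow> bool"
    and ins :: "nat \<Rightarrow> nat \<Rightarrow> nat list \<Rightarrow> nat list \<Rightarrow> nat list"
  assumes good_Nil: "good []"
    and site_end: "site w []"
    and ins_single: "ins x 1 u v = u @ x # v"
    and ins_end: "a > 0 \<Longrightarrow> ins x a w [] = w @ replicate a x"
    and mset_ins: "a > 0 \<Longrightarrow> mset (ins x a u v) = mset u + replicate_mset a x + mset v"
    and ins_prefix: "a > 0 \<Longrightarrow> \<exists>r. ins x a u v = u @ x # r"
    and filter_ins: "x \<notin> set u \<Longrightarrow> x \<notin> set v \<Longrightarrow> filter (\<lambda>y. y \<noteq> x) (ins x a u v) = u @ v"
    and good_ins: "\<forall>y\<in>set u \<union> set v. x < y \<Longrightarrow> a > 0 \<Longrightarrow>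
      good (ins x a u v) \<longleftrightarrow> good (u @ v) \<and> site u v"
    and good_decompose: "good w \<Longrightarrow> x \<in> set w \<Longrightarrow> \<forall>y\<in>set w. x \<le> y \<Longrightarrow>
      \<exists>u v a. x \<notin> set u \<and> x \<notin> set v \<and> a > 0 \<and> w = ins x a u v"
    and site_filter: "\<forall>y\<in>set u \<union> set v. x \<le> y \<Longrightarrow>
      \<not> subseq [x,x] (u @ v) \<or> (\<forall>y>x. \<not> subseq [x,y] (u @ v)) \<Longrightarrow>
      site u v \<longleftrightarrow> site (filter (\<lambda>y. y \<noteq> x) u) (filter (\<lambda>y. y \<noteq> x) v)"
    and inner_ranks: "\<forall>y\<in>set w. x < y \<Longrightarrow> a \<ge> 2 \<Longrightarrow>
      bij_betw (\<lambda>p. card (sites site (ins x a (take p w) (drop p w))))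
        (sites site w - {length w}) {3..card (sites site w) + 1}"
begin

abbreviation insert_at :: "nat \<Rightarrow> nat \<Rightarrow> nat list \<Rightarrow> nat \<Rightarrow> nat list" where
  "insert_at x a w p \<equiv> ins x a (take p w) (drop p w)"

lemma length_in_sites: "length w \<in> sites site w"
  by (simp add: sites_def site_end)

text \<open>Deleting the only \<open>x\<close> sends sites of the child to sites of
  \<open>w\<close>. The cuts just before and just after \<open>x\<close> both go to
  \<open>p\<close>, and every other site has one preimage.\<close>

lemma card_sites_single:
  assumes "\<forall>y\<in>set w. x < y" "p \<in> sites site w"
  shows "card (sites site (insert_at x 1 w p)) = card (sites site w) + 1"
proof -
  let ?w = "take p w @ x # drop p w"
  have p: "p \<le> length w" using assms by (simp add: sites_def)
  have x: "x \<notin> set w" "x \<notin> set (take q w)" "x \<notin> set (drop q w)" for q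
    using assms(1) by (auto dest: in_set_takeD in_set_dropD)
  have cnt: "\<not> subseq [x,x] (take q ?w @ drop q ?w)" for q
    using x unfolding append_take_drop_id
    by (auto simp: subseq_pair_append subseq_singleton_left dest!: set_subseq)
  have le: "\<forall>y\<in>set (take q ?w) \<union> set (drop q ?w). x \<le> y" for q
    using assms(1) by (auto dest!: in_set_takeD in_set_dropD simp: less_imp_le)
  \<comment> \<open>For a cut to the left of \<open>x\<close>, the letter is deleted from the right
    factor and positions stay the same.\<close>
  have low: "q \<in> sites site ?w \<longleftrightarrow> q \<in> sites site w" if "q \<le> p" for q
  proof -
    have 1: "take q ?w = take q w" using that p by simp
    have "x \<notin> set (drop q (take p w))" using x by (auto dest: in_set_dropD)
    hence "filter (\<lambda>y. y \<noteq> x) (drop q ?w) = drop q (take p w @ drop p w)"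
      using that p x by (simp add: filter_neq_id del: append_take_drop_id)
    hence 2: "filter (\<lambda>y. y \<noteq> x) (drop q ?w) = drop q w" by simp
    show ?thesis
      using that p site_filter[OF le disjI1[OF cnt], of q]
      unfolding sites_def mem_Collect_eq 1 2 filter_neq_id[OF x(2)] by simp
  qed
  \<comment> \<open>For a cut to the right of \<open>x\<close>, the letter is deleted from the left
    factor and positions drop by one.\<close>
  have high: "Suc q \<in> sites site ?w \<longleftrightarrow> q \<in> sites site w" if "p \<le> q" for q
  proof -
    have 1: "drop (Suc q) ?w = drop q w" using that p by (simp add: Suc_diff_le)
    have "x \<notin> set (take (q - p) (drop p w))" using x by (auto dest: in_set_takeD)
    hence "filter (\<lambda>y. y \<noteq> x) (take (Suc q) ?w) = take q (take p w @ drop p w)"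
      using that p x by (simp add: filter_neq_id Suc_diff_le min_def del: append_take_drop_id)
    hence 2: "filter (\<lambda>y. y \<noteq> x) (take (Suc q) ?w) = take q w" by simp
    show ?thesis
      using that p site_filter[OF le disjI1[OF cnt], of "Suc q"]
      unfolding sites_def mem_Collect_eq 1 2 filter_neq_id[OF x(3)] by simp
  qed
  have "sites site ?w = {q\<in>sites site w. q \<le> p} \<union> Suc ` {q\<in>sites site w. p \<le> q}"
  proof (rule set_eqI)
    fix q
    show "q \<in> sites site ?w \<longleftrightarrow>
      q \<in> {q\<in>sites site w. q \<le> p} \<union> Suc ` {q\<in>sites site w. p \<le> q}"
    proof (cases "q \<le> p")
      case True
      thus ?thesis using low[OF True] by (auto simp del: append_take_drop_id)
    next
      case False
      then obtain r where "q = Suc r" "p \<le> r" by (cases q) auto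
      thus ?thesis using high[of r] by auto
    qed
  qed
  also have "card \<dots> = card {q\<in>sites site w. q \<le> p} + card {q\<in>sites site w. p \<le> q}"
    by (subst card_Un_disjoint) (auto simp: card_image)
  \<comment> \<open>The two halves cover all sites and overlap exactly in \<open>p\<close>, which
    yields the additional 1.\<close>
  also have "\<dots> = card ({q\<in>sites site w. q \<le> p} \<union> {q\<in>sites site w. p \<le> q})
    + card ({q\<in>sites site w. q \<le> p} \<inter> {q\<in>sites site w. p \<le> q})"
    by (rule card_Un_Int) auto
  also have "{q\<in>sites site w. q \<le> p} \<union> {q\<in>sites site w. p \<le> q} = sites site w" by auto
  also have "{q\<in>sites site w. q \<le> p} \<inter> {q\<in>sites site w. p \<le> q} = {p}" using assms(2) by auto
  finally show ?thesis by (simp add: ins_single[unfolded One_nat_def])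
qed

text \<open>Cuts inside \<open>w\<close> keep their status when the appended copies are deleted.
  Each of the \<open>a\<close> cuts beyond \<open>w\<close> has only copies of \<open>x\<close> on
  its right; deleting them leaves the empty factor, where \<open>site_end\<close> applies.\<close>

lemma card_sites_end:
  assumes "\<forall>y\<in>set w. x < y" "a > 0"
  shows "card (sites site (insert_at x a w (length w))) = card (sites site w) + a"
proof -
  let ?w = "w @ replicate a x"
  have x: "x \<notin> set w" "x \<notin> set (take q w)" "x \<notin> set (drop q w)" for q
    using assms(1) by (auto dest: in_set_takeD in_set_dropD)
  have no: "\<forall>y>x. \<not> subseq [x,y] (take q ?w @ drop q ?w)" for q
    using x by (simp only: append_take_drop_id subseq_pair_append)
      (auto dest!: set_subseq)
  have le: "\<forall>y\<in>set (take q ?w) \<union> set (drop q ?w). x \<le> y" for q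
    using assms(1) by (auto dest!: in_set_takeD in_set_dropD simp: less_imp_le)
  have "q \<in> sites site ?w \<longleftrightarrow> q \<in> sites site w \<union> {length w<..length w + a}" for q
  proof (cases "q \<le> length w")
    case True
    have "filter (\<lambda>y. y \<noteq> x) (drop q ?w) = drop q w"
      "filter (\<lambda>y. y \<noteq> x) (take q ?w) = take q w"
      using True x by (simp_all add: filter_neq_id)
    thus ?thesis
      using True site_filter[OF le disjI2[OF no], of q] by (auto simp: sites_def)
  next
    case False
    have "filter (\<lambda>y. y \<noteq> x) (drop q ?w) = []"
      using False by simp
    thus ?thesis
      using False site_filter[OF le disjI2[OF no], of q] by (auto simp: sites_def site_end)
  qed
  hence "sites site ?w = sites site w \<union> {length w<..length w + a}" by blast
  also have "card \<dots> = card (sites site w) + a"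
    by (subst card_Un_disjoint) (auto simp: sites_def)
  finally show ?thesis using assms(2) by (simp add: ins_end)
qed

text \<open>For several copies, the end site gives the term \<open>f (n + a)\<close>, where
  \<open>n\<close> is the number of sites of \<open>w\<close>, and \<open>inner_ranks\<close>
  reindexes the sum over all other sites.\<close>

lemma sum_insert_at:
  assumes "\<forall>y\<in>set w. x < y" "a > 0"
  shows "(\<Sum>p\<in>sites site w. f (card (sites site (insert_at x a w p)))) =
    child_sum a f (card (sites site w))"
proof (cases "a = 1")
  case True
  have "f (card (sites site (insert_at x a w p))) = f (card (sites site w) + 1)"
    if "p \<in> sites site w" for p
    using card_sites_single[OF assms(1) that] True by simp
  thus ?thesis using True by (simp add: child_sum_def)
next
  case False
  hence "(\<Sum>p\<in>sites site w - {length w}. f (card (sites site (insert_at x a w p)))) =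
      sum f {3..card (sites site w) + 1}"
    using assms by (intro sum.reindex_bij_betw inner_ranks) auto
  thus ?thesis
    using False card_sites_end[OF assms]
    by (simp add: sum.remove[OF _ length_in_sites] child_sum_def)
qed

text \<open>Every good word arises from a parent by \<open>good_decompose\<close>, and
  \<open>good_ins\<close> translates goodness of the child into goodness of the parent and
  admissibility of the cut.\<close>

lemma good_words_eq_image:
  assumes "\<forall>y\<in>#S. x < y" "a > 0"
  shows "{w. good w \<and> mset w = S + replicate_mset a x} =
    (\<lambda>(w, p). insert_at x a w p) ` (SIGMA w:{w. good w \<and> mset w = S}. sites site w)"
    (is "?L = ?f ` ?D")
proof (intro equalityI subsetI)
  fix w assume "w \<in> ?L"
  hence w: "good w" "mset w = S + replicate_mset a x" by auto
  have "set w = insert x (set_mset S)"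
    using w(2) assms(2) by (metis Un_commute insert_is_Un set_mset_mset set_mset_replicate_mset_subset
        set_mset_union not_gr_zero)
  then obtain u v b where uv: "x \<notin> set u" "x \<notin> set v" "b > 0" "w = ins x b u v"
    using good_decompose[OF w(1), of x] assms(1) by (auto simp: less_imp_le)
  have eq: "mset u + replicate_mset b x + mset v = S + replicate_mset a x"
    using w(2) uv mset_ins by metis
  have "x \<notin># S" using assms(1) by auto
  hence cnt: "count S x = 0" "count (mset u) x = 0" "count (mset v) x = 0"
    using uv by (simp_all add: count_eq_zero_iff)
  \<comment> \<open>Compare the multiplicities of \<open>x\<close> on both sides of
    \<open>eq\<close>.\<close>
  have "b = a"
    using arg_cong[OF eq, of "\<lambda>M. count M x"] by (simp add: cnt)
  hence S: "mset (u @ v) = S" using eq by (simp add: ac_simps)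
  have less: "\<forall>y\<in>set u \<union> set v. x < y"
    using assms(1) unfolding S[symmetric] by simp
  have "good (u @ v) \<and> site u v"
    using good_ins[OF less assms(2)] w(1) uv \<open>b = a\<close> by simp
  hence "(u @ v, length u) \<in> ?D" using S by (auto simp: sites_def)
  thus "w \<in> ?f ` ?D"
    using uv \<open>b = a\<close> by (intro image_eqI[of _ _ "(u @ v, length u)"]) auto
next
  fix w' assume "w' \<in> ?f ` ?D"
  then obtain w p where w: "good w" "mset w = S" "p \<in> sites site w" "w' = insert_at x a w p"
    by auto
  have less: "\<forall>y\<in>set (take p w) \<union> set (drop p w). x < y"
    using assms(1) w(2) by (auto dest: in_set_takeD in_set_dropD)
  have "mset (take p w) + mset (drop p w) = S"
    using w(2) by (metis append_take_drop_id mset_append)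
  thus "w' \<in> ?L"
    using good_ins[OF less assms(2)] w mset_ins[OF assms(2)]
    by (auto simp: sites_def ac_simps)
qed

text \<open>Deleting \<open>x\<close> from the child recovers the parent, and the length of the
  prefix before the first \<open>x\<close> recovers the cut.\<close>

lemma inj_on_insert_at:
  assumes "x \<notin># S" "a > 0"
  shows "inj_on (\<lambda>(w, p). insert_at x a w p) (SIGMA w:{w. good w \<and> mset w = S}. sites site w)"
proof (rule inj_onI, clarify)
  fix w p w' p'
  assume w: "mset w' = mset w" "S = mset w" "p \<in> sites site w" "p' \<in> sites site w'"
    and eq: "insert_at x a w p = insert_at x a w' p'"
  have x: "x \<notin> set (take q w)" "x \<notin> set (drop q w)" "x \<notin> set (take q w')" "x \<notin> set (drop q w')" for q
    using assms(1) w(1,2) by (auto dest!: in_set_takeD in_set_dropD) (metis set_mset_mset)+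
  have "w = w'"
    using arg_cong[OF eq, of "filter (\<lambda>y. y \<noteq> x)"] by (simp add: filter_ins x)
  moreover have tw: "takeWhile (\<lambda>y. y \<noteq> x) (insert_at x a v q) = take q v"
    if "x \<notin> set (take q v)" for v q
    using ins_prefix[OF assms(2), of x "take q v" "drop q v"] that
    by (auto simp: takeWhile_append)
  have "take p w = take p' w'"
    using tw[of p w] tw[of p' w'] x eq by simp
  hence "p = p'"
    using w by (metis (mono_tags, lifting) \<open>w = w'\<close> sites_def length_take mem_Collect_eq min.absorb2)
  ultimately show "w = w' \<and> p = p'" by simp
qed

text \<open>The smallest letter is inserted last, so the induction strips it first and replaces the
  weight \<open>f\<close> by \<open>child_sum a f\<close>. This is why \<open>f\<close> must be
  arbitrary although only the constant weight 1 is needed for counting.\<close>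

lemma sum_good_words:
  "(\<Sum>w | good w \<and> mset w = S. f (card (sites site w))) =
    tree_sum (map (count S) (sorted_list_of_set (set_mset S))) f"
proof (induction "card (set_mset S)" arbitrary: S f rule: less_induct)
  case less
  show ?case
  proof (cases "S = {#}")
    case True
    have "sites site [] = {0}" using site_end by (auto simp: sites_def)
    moreover have "{w. good w \<and> w = []} = {[]}" using good_Nil by auto
    ultimately show ?thesis using True by simp
  next
    case False
    define x where "x = Min (set_mset S)"
    define a where "a = count S x"
    define T where "T = filter_mset (\<lambda>y. y \<noteq> x) S"
    have x: "x \<in># S" "\<forall>y\<in>#S. x \<le> y" using False by (auto simp: x_def)
    have a: "a > 0" using x by (simp add: a_def)
    have S: "S = T + replicate_mset a x"
      by (rule multiset_eqI) (auto simp: T_def a_def)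
    have T: "set_mset T = set_mset S - {x}" by (auto simp: T_def)
    have less_T: "\<forall>y\<in>#T. x < y" using x T by (metis DiffE insertI1 order_less_le)
    have card: "card (set_mset T) < card (set_mset S)"
      using x unfolding T by (intro psubset_card_mono) auto
    let ?D = "{w. good w \<and> mset w = T}"
    have fin: "finite ?D"
      by (rule finite_subset[of _ "permutations_of_multiset T"])
        (auto simp: permutations_of_multiset_def[symmetric] permutations_of_multisetI)
    have "(\<Sum>w | good w \<and> mset w = S. f (card (sites site w))) =
        (\<Sum>(w, p)\<in>(SIGMA w:?D. sites site w). f (card (sites site (insert_at x a w p))))"
      unfolding S good_words_eq_image[OF less_T a]
      using less_T by (subst sum.reindex[OF inj_on_insert_at[OF _ a]]) (auto simp: case_prod_unfold)
    also have "\<dots> = (\<Sum>w\<in>?D. \<Sum>p\<in>sites site w. f (card (sites site (insert_at x a w p))))"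
      using fin by (subst sum.Sigma) auto
    also have "\<dots> = (\<Sum>w\<in>?D. child_sum a f (card (sites site w)))"
      using less_T a by (intro sum.cong refl sum_insert_at) auto
    also have "\<dots> = tree_sum (map (count T) (sorted_list_of_set (set_mset T))) (child_sum a f)"
      using less.hyps[OF card] .
    also have "map (count T) (sorted_list_of_set (set_mset T)) =
        map (count S) (sorted_list_of_set (set_mset S - {x}))"
      unfolding T by (intro map_cong refl) (auto simp: T_def)
    \<comment> \<open>The sorted support of \<open>S\<close> starts with its minimum
      \<open>x\<close>, so \<open>tree_sum\<close> consumes the multiplicity \<open>a\<close>
      first.\<close>
    also have "tree_sum \<dots> (child_sum a f) =
        tree_sum (map (count S) (sorted_list_of_set (set_mset S))) f"
      using False by (simp add: sorted_list_of_set_nonempty x_def a_def)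
    finally show ?thesis .
  qed
qed

text \<open>The right-hand side mentions only \<open>S\<close>, neither \<open>good\<close> nor
  \<open>site\<close>, so any two insertion schemes have equal counts.\<close>

lemma card_good_permutations:
  "card {w \<in> permutations_of_multiset S. good w} =
    tree_sum (map (count S) (sorted_list_of_set (set_mset S))) (\<lambda>_. 1)"
  using sum_good_words[of "\<lambda>_. 1" S]
  by (simp add: permutations_of_multiset_def conj_commute)

end

section \<open>Occurrences of patterns that use the smallest letter\<close>

lemma avoids_Nil: "p \<noteq> [] \<Longrightarrow> avoids_pattern [] p"
  by (auto simp: avoids_pattern_def contains_pattern_def)

lemma subseq_replicate_iff: "subseq q (replicate n x) \<longleftrightarrow> set q \<subseteq> {x} \<and> length q \<le> n"
proof (induction n arbitrary: q)
  case 0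
  show ?case by (cases q) auto
next
  case (Suc n)
  show ?case
  proof (cases q)
    case (Cons y r)
    thus ?thesis using Suc.IH[of r] Suc.IH[of q] by auto
  qed simp
qed

text \<open>Occurrences without \<open>x\<close> survive its deletion. In the others
  \<open>x\<close> is the least letter used; the bound on \<open>set q\<close> records this, so that
  later \<open>x\<close> can be identified with the 1 of a pattern.\<close>

lemma subseq_min_cases:
  assumes "\<forall>z\<in>set w. x \<le> z"
  shows "subseq q w \<longleftrightarrow> subseq q (filter (\<lambda>y. y \<noteq> x) w) \<or>
    x \<in> set q \<and> (\<forall>z\<in>set q. x \<le> z) \<and> subseq q w"
proof -
  have "subseq q (filter (\<lambda>y. y \<noteq> x) w)" if "subseq q w" "x \<notin> set q"
  proof -
    have "filter (\<lambda>y. y \<noteq> x) q = q" using that(2) by (auto simp: filter_id_conv)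
    thus ?thesis using subseq_filter[OF that(1), of "\<lambda>y. y \<noteq> x"] by simp
  qed
  moreover have "subseq q w" if "subseq q (filter (\<lambda>y. y \<noteq> x) w)"
    using that subseq_filter_left subseq_order.order_trans by blast
  ultimately show ?thesis using assms set_subseq by blast
qed

text \<open>New occurrences caused by the minimal letter \<open>x\<close> must use it as the 1 of
  the pattern. The same reduction is made for the other four patterns.\<close>

lemma avoids_112_min:
  assumes "\<forall>z\<in>set w. x \<le> z"
  shows "avoids_pattern w [1,1,2] \<longleftrightarrow>
    avoids_pattern (filter (\<lambda>y. y \<noteq> x) w) [1,1,2] \<and> (\<forall>y>x. \<not> subseq [x,x,y] w)"
proof -
  have "subseq [a,a,b] w \<longleftrightarrow>
      subseq [a,a,b] (filter (\<lambda>y. y \<noteq> x) w) \<or> a = x \<and> subseq [x,x,b] w"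
    if "a < b" for a b
    using subseq_min_cases[OF assms, of "[a,a,b]"] that by auto
  thus ?thesis unfolding avoids_112 by blast
qed

lemma avoids_121_min:
  assumes "\<forall>z\<in>set w. x \<le> z"
  shows "avoids_pattern w [1,2,1] \<longleftrightarrow>
    avoids_pattern (filter (\<lambda>y. y \<noteq> x) w) [1,2,1] \<and> (\<forall>y>x. \<not> subseq [x,y,x] w)"
proof -
  have "subseq [a,b,a] w \<longleftrightarrow>
      subseq [a,b,a] (filter (\<lambda>y. y \<noteq> x) w) \<or> a = x \<and> subseq [x,b,x] w"
    if "a < b" for a b
    using subseq_min_cases[OF assms, of "[a,b,a]"] that by auto
  thus ?thesis unfolding avoids_121 by blast
qed

lemma avoids_1223_min:
  assumes "\<forall>z\<in>set w. x \<le> z"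
  shows "avoids_pattern w [1,2,2,3] \<longleftrightarrow> avoids_pattern (filter (\<lambda>y. y \<noteq> x) w) [1,2,2,3] \<and>
    (\<forall>y>x. \<forall>z>y. \<not> subseq [x,y,y,z] w)"
proof -
  have "subseq [a,b,b,c] w \<longleftrightarrow>
      subseq [a,b,b,c] (filter (\<lambda>y. y \<noteq> x) w) \<or> a = x \<and> subseq [x,b,b,c] w"
    if "a < b" "b < c" for a b c
    using subseq_min_cases[OF assms, of "[a,b,b,c]"] that by auto
  thus ?thesis unfolding avoids_1223 by blast
qed

lemma avoids_2213_min:
  assumes "\<forall>z\<in>set w. x \<le> z"
  shows "avoids_pattern w [2,2,1,3] \<longleftrightarrow> avoids_pattern (filter (\<lambda>y. y \<noteq> x) w) [2,2,1,3] \<and>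
    (\<forall>y>x. \<forall>z>y. \<not> subseq [y,y,x,z] w)"
proof -
  have "subseq [b,b,a,c] w \<longleftrightarrow>
      subseq [b,b,a,c] (filter (\<lambda>y. y \<noteq> x) w) \<or> a = x \<and> subseq [b,b,x,c] w"
    if "a < b" "b < c" for a b c
    using subseq_min_cases[OF assms, of "[b,b,a,c]"] that by auto
  thus ?thesis unfolding avoids_2213 by blast
qed

lemma avoids_2312_min:
  assumes "\<forall>z\<in>set w. x \<le> z"
  shows "avoids_pattern w [2,3,1,2] \<longleftrightarrow> avoids_pattern (filter (\<lambda>y. y \<noteq> x) w) [2,3,1,2] \<and>
    (\<forall>y>x. \<forall>z>y. \<not> subseq [y,z,x,y] w)"
proof -
  have "subseq [b,c,a,b] w \<longleftrightarrow>
      subseq [b,c,a,b] (filter (\<lambda>y. y \<noteq> x) w) \<or> a = x \<and> subseq [b,c,x,b] w"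
    if "a < b" "b < c" for a b c
    using subseq_min_cases[OF assms, of "[b,c,a,b]"] that by auto
  thus ?thesis unfolding avoids_2312 by blast
qed

section \<open>The two insertions and the three site conditions\<close>

definition ins_block :: "nat \<Rightarrow> nat \<Rightarrow> nat list \<Rightarrow> nat list \<Rightarrow> nat list" where
  "ins_block x a u v = u @ replicate a x @ v"

text \<open>For \<open>a = 0\<close> the truncated \<open>a - 1\<close> would still leave one copy
  of \<open>x\<close>; the hypotheses \<open>a > 0\<close> in the locale exclude this.\<close>

definition ins_split :: "nat \<Rightarrow> nat \<Rightarrow> nat list \<Rightarrow> nat list \<Rightarrow> nat list" where
  "ins_split x a u v = u @ [x] @ v @ replicate (a - 1) x"

text \<open>A new smallest letter at the cut plays the 1 of the pattern. The condition, like the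
  next two, forbids the remaining letters on their proper sides: 223 on the right here, then 22 left
  and 3 right, then 23 left and 2 right.\<close>

definition site_1223 :: "nat list \<Rightarrow> nat list \<Rightarrow> bool" where
  "site_1223 u v \<longleftrightarrow> (\<forall>y z. y < z \<longrightarrow> \<not> subseq [y,y,z] v)"

definition site_2213 :: "nat list \<Rightarrow> nat list \<Rightarrow> bool" where
  "site_2213 u v \<longleftrightarrow> (\<forall>y z. y < z \<longrightarrow> subseq [y,y] u \<longrightarrow> z \<notin> set v)"

definition site_2312 :: "nat list \<Rightarrow> nat list \<Rightarrow> bool" where
  "site_2312 u v \<longleftrightarrow> (\<forall>y z. y < z \<longrightarrow> subseq [y,z] u \<longrightarrow> y \<notin> set v)"

lemma filter_ins_block:
  assumes "x \<notin> set u" "x \<notin> set v"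
  shows "filter (\<lambda>y. y \<noteq> x) (ins_block x a u v) = u @ v"
  using assms by (simp add: ins_block_def filter_neq_id)

lemma filter_ins_split:
  assumes "x \<notin> set u" "x \<notin> set v"
  shows "filter (\<lambda>y. y \<noteq> x) (ins_split x a u v) = u @ v"
  using assms by (simp add: ins_split_def filter_neq_id)

text \<open>Take the first \<open>x\<close> and the maximal run starting there. A later
  \<open>x\<close> would be separated from the run by a larger letter and complete a 121.\<close>

lemma block_decompose:
  assumes "avoids_pattern w [1,2,1]" "x \<in> set w" "\<forall>y\<in>set w. x \<le> y"
  shows "\<exists>u v a. x \<notin> set u \<and> x \<notin> set v \<and> a > 0 \<and> w = ins_block x a u v"
proof -
  obtain u t where w: "w = u @ x # t" "x \<notin> set u"
    using assms(2) by (metis split_list_first)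
  define v where "v = dropWhile (\<lambda>y. y = x) t"
  have t: "t = replicate (length (takeWhile (\<lambda>y. y = x) t)) x @ v"
  proof -
    have "replicate (length (takeWhile (\<lambda>y. y = x) t)) x = takeWhile (\<lambda>y. y = x) t"
      by (rule replicate_length_same) (auto dest: set_takeWhileD)
    thus ?thesis by (simp add: v_def)
  qed
  have "x \<notin> set v"
  proof
    assume "x \<in> set v"
    moreover from this have "v \<noteq> []" by auto
    moreover from this have hd: "hd v \<noteq> x"
      unfolding v_def by (rule hd_dropWhile)
    ultimately have "subseq [hd v, x] v"
      by (cases v) (auto simp: subseq_singleton_left)
    hence "subseq [x, hd v, x] (x # t)"
      by (subst t) (auto intro: subseq_drop_many)
    hence "subseq [x, hd v, x] w"
      unfolding w by (rule subseq_drop_many)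
    moreover from this have "x < hd v"
      using assms(3) hd by (auto dest!: set_subseq simp: less_le)
    ultimately show False using assms(1) unfolding avoids_121 by blast
  qed
  thus ?thesis
    using w t by (intro exI[of _ u] exI[of _ v]
        exI[of _ "Suc (length (takeWhile (\<lambda>y. y = x) t))"]) (auto simp: ins_block_def)
qed

text \<open>A letter other than \<open>x\<close> after the second copy of \<open>x\<close> would be
  larger and complete a 112, so from the second copy on the word is constant.\<close>

lemma split_decompose:
  assumes "avoids_pattern w [1,1,2]" "x \<in> set w" "\<forall>y\<in>set w. x \<le> y"
  shows "\<exists>u v a. x \<notin> set u \<and> x \<notin> set v \<and> a > 0 \<and> w = ins_split x a u v"
proof -
  obtain u t where w: "w = u @ x # t" "x \<notin> set u"
    using assms(2) by (metis split_list_first)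
  define v where "v = takeWhile (\<lambda>y. y \<noteq> x) t"
  define s where "s = dropWhile (\<lambda>y. y \<noteq> x) t"
  have "y = x" if "y \<in> set s" for y
  proof (rule ccontr)
    assume "y \<noteq> x"
    have "s \<noteq> []" using that by auto
    moreover from this have "hd s = x" using hd_dropWhile unfolding s_def by blast
    ultimately obtain r where r: "s = x # r" by (metis list.collapse)
    hence "subseq [x,y] s" using that \<open>y \<noteq> x\<close> by (auto simp: subseq_singleton_left)
    hence "subseq [x,y] (v @ s)" by (rule subseq_drop_many)
    hence "subseq [x,x,y] (x # t)" by (simp add: v_def s_def)
    hence *: "subseq [x,x,y] w" unfolding w by (rule subseq_drop_many)
    hence "x < y" using assms(3) \<open>y \<noteq> x\<close> by (auto dest!: set_subseq simp: less_le)
    thus False using assms(1) * unfolding avoids_112 by blast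
  qed
  hence "s = replicate (length s) x" by (metis replicate_length_same)
  moreover have "x \<notin> set v" unfolding v_def by (auto dest: set_takeWhileD)
  moreover have "t = v @ s" by (simp add: v_def s_def)
  ultimately show ?thesis
    using w by (intro exI[of _ u] exI[of _ v] exI[of _ "Suc (length s)"])
      (simp add: ins_split_def)
qed

section \<open>Sites after inserting several copies at an inner cut\<close>

text \<open>The child keeps the sites up to \<open>p\<close> and gains two positions beyond
  \<open>p\<close>, so its number of sites is the rank of \<open>p\<close> plus 2.\<close>

lemma inner_ranks_low:
  assumes "\<And>p. p \<in> sites site w \<Longrightarrow> p < length w \<Longrightarrow>
      sites site (w' p) = {q\<in>sites site w. q \<le> p} \<union> {p + 1, length w + a}"
    and "a \<ge> 2" "length w \<in> sites site w"
  shows "bij_betw (\<lambda>p. card (sites site (w' p))) (sites site w - {length w})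
    {3..card (sites site w) + 1}"
proof -
  have "card (sites site (w' p)) = card {q\<in>sites site w. q \<le> p} + 2"
    if "p \<in> sites site w - {length w}" for p
  proof -
    have p: "p \<in> sites site w" "p < length w" using that by (auto simp: sites_def)
    show ?thesis unfolding assms(1)[OF p]
      using assms(2) p by (subst card_Un_disjoint) auto
  qed
  moreover have "\<forall>q\<in>sites site w. q \<le> length w" by (simp add: sites_def)
  note bij_betw_rank_below_top(1)[OF finite_sites assms(3) this]
  ultimately show ?thesis by (rule iffD2[OF bij_betw_cong])
qed

text \<open>The child keeps the sites from \<open>p\<close> on, shifted by \<open>a\<close>, and
  gains one position just below all of them, so the count is the rank from above plus 1.\<close>

lemma inner_ranks_high:
  assumes "\<And>p. p \<in> sites site w \<Longrightarrow> p < length w \<Longrightarrow>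
      sites site (w' p) = insert (p + a - 1) ((\<lambda>q. q + a) ` {q\<in>sites site w. p \<le> q})"
    and "a \<ge> 2" "length w \<in> sites site w"
  shows "bij_betw (\<lambda>p. card (sites site (w' p))) (sites site w - {length w})
    {3..card (sites site w) + 1}"
proof -
  have "card (sites site (w' p)) = card {q\<in>sites site w. p \<le> q} + 1"
    if "p \<in> sites site w - {length w}" for p
  proof -
    have p: "p \<in> sites site w" "p < length w" using that by (auto simp: sites_def)
    show ?thesis unfolding assms(1)[OF p]
      using assms(2) p by (subst card_insert_disjoint) (auto simp: card_image)
  qed
  moreover have "\<forall>q\<in>sites site w. q \<le> length w" by (simp add: sites_def)
  note bij_betw_rank_below_top(2)[OF finite_sites assms(3) this]
  ultimately show ?thesis by (rule iffD2[OF bij_betw_cong])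
qed

lemma last_in_drop: "q < length w \<Longrightarrow> last w \<in> set (drop q w)"
  by (metis drop_eq_Nil last_drop last_in_set not_le)

lemma subseq_take_append: "subseq s u \<Longrightarrow> length u \<le> q \<Longrightarrow> subseq s (take q (u @ v))"
  by (simp add: subseq_rev_drop_many)

text \<open>Up to the cut \<open>p + 1\<close> at most one \<open>x\<close> lies on the left, so no
  new repeated letter appears there. From \<open>p + 2\<close> on the left factor contains
  \<open>x\<close> twice while the larger last letter of \<open>w\<close> stays on the right, until
  the cut reaches the end.\<close>

lemma sites_ins_block_2213:
  assumes "\<forall>y\<in>set w. x < y" "a \<ge> 2" "p \<in> sites site_2213 w" "p < length w"
  shows "sites site_2213 (ins_block x a (take p w) (drop p w)) =
    {q\<in>sites site_2213 w. q \<le> p} \<union> {p + 1, length w + a}"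
proof (rule set_eqI)
  fix q
  let ?w = "ins_block x a (take p w) (drop p w)"
  have len: "length ?w = length w + a" using assms(4) by (simp add: ins_block_def)
  have x: "x \<notin> set w" using assms(1) by auto
  consider "q \<le> p" | "q = p + 1" | "p + 2 \<le> q" "q < length w + a" | "q \<ge> length w + a"
    by linarith
  thus "q \<in> sites site_2213 ?w \<longleftrightarrow>
    q \<in> {q\<in>sites site_2213 w. q \<le> p} \<union> {p + 1, length w + a}"
  proof cases
    case 1
    have t: "take q ?w = take q w" using 1 assms(4) by (simp add: ins_block_def min_def)
    have "drop q ?w = drop q (take p w) @ replicate a x @ drop p w"
      using 1 assms(4) by (simp add: ins_block_def)
    moreover have "drop q (take p w @ drop p w) = drop q (take p w) @ drop p w"
      using 1 assms(4) by (simp del: append_take_drop_id)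
    hence "drop q w = drop q (take p w) @ drop p w" by simp
    ultimately have d: "set (drop q ?w) = insert x (set (drop q w))"
      using assms(2) by auto
    \<comment> \<open>The right factor gains only \<open>x\<close>, which is too small to be the
      larger letter \<open>z\<close>.\<close>
    have "z \<noteq> x" if "y < z" "subseq [y,y] (take q w)" for y z
      using that assms(1) by (fastforce dest!: set_subseq in_set_takeD)
    thus ?thesis
      using 1 assms(4) unfolding sites_def mem_Collect_eq site_2213_def t d len by auto
  next
    case 2
    have t: "take q ?w = take p w @ [x]"
      using 2 assms(2,4) by (cases a) (auto simp: ins_block_def)
    have "drop q ?w = replicate (a - 1) x @ drop p w"
      using 2 assms(2,4) by (cases a) (auto simp: ins_block_def)
    hence d: "set (drop q ?w) \<subseteq> insert x (set (drop p w))" by auto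
    have "site_2213 (take q ?w) (drop q ?w)"
      unfolding site_2213_def
    proof (intro allI impI notI)
      fix y z assume yz: "y < z" "subseq [y,y] (take q ?w)" "z \<in> set (drop q ?w)"
      hence "subseq [y,y] (take p w)" "z \<in> insert x (set (drop p w))"
        using x d unfolding t by (auto simp: subseq_pair_append dest: in_set_takeD split: if_splits)
      moreover from this have "z \<noteq> x"
        using yz assms(1) by (fastforce dest!: set_subseq in_set_takeD)
      ultimately show False using assms(3) yz(1) unfolding sites_def site_2213_def by auto
    qed
    thus ?thesis using 2 assms(2,4) len by (auto simp: sites_def)
  next
    case 3
    have "?w = (take p w @ [x,x]) @ (replicate (a - 2) x @ drop p w)"
    proof -
      obtain b where "a = Suc (Suc b)" using assms(2) by (metis add_2_eq_Suc le_Suc_ex)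
      thus ?thesis by (simp add: ins_block_def)
    qed
    moreover have "subseq [x,x] (take p w @ [x,x])" by (rule subseq_drop_many) simp
    moreover have "length (take p w @ [x,x]) \<le> q" using 3(1) assms(4) by simp
    ultimately have "subseq [x,x] (take q ?w)" by (simp only: subseq_take_append)
    moreover have "last ?w \<in> set (drop q ?w)" using 3 len by (intro last_in_drop) simp
    moreover have "last ?w = last w" using assms(4) by (simp add: ins_block_def)
    moreover have "x < last w" using assms(1,4) by (metis last_in_set length_0_conv not_less_zero)
    ultimately show ?thesis using 3 assms(4) unfolding sites_def site_2213_def by auto
  next
    case 4
    thus ?thesis using assms(2,4) len by (auto simp: sites_def site_2213_def)
  qed
qed

text \<open>Up to the cut \<open>p + 1\<close> the first \<open>x\<close> has no letter after it on
  the left. From \<open>p + 2\<close> on it is followed there by a larger letter, and a final copy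
  of \<open>x\<close> stays on the right until the cut reaches the end.\<close>

lemma sites_ins_split_2312:
  assumes "\<forall>y\<in>set w. x < y" "a \<ge> 2" "p \<in> sites site_2312 w" "p < length w"
  shows "sites site_2312 (ins_split x a (take p w) (drop p w)) =
    {q\<in>sites site_2312 w. q \<le> p} \<union> {p + 1, length w + a}"
proof (rule set_eqI)
  fix q
  let ?w = "ins_split x a (take p w) (drop p w)"
  have len: "length ?w = length w + a" using assms(2,4) by (simp add: ins_split_def)
  have x: "x \<notin> set w" using assms(1) by auto
  consider "q \<le> p" | "q = p + 1" | "p + 2 \<le> q" "q < length w + a" | "q \<ge> length w + a"
    by linarith
  thus "q \<in> sites site_2312 ?w \<longleftrightarrow>
    q \<in> {q\<in>sites site_2312 w. q \<le> p} \<union> {p + 1, length w + a}"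
  proof cases
    case 1
    have t: "take q ?w = take q w" using 1 assms(4) by (simp add: ins_split_def min_def)
    have "drop q ?w = drop q (take p w) @ [x] @ drop p w @ replicate (a - 1) x"
      using 1 assms(4) by (simp add: ins_split_def)
    moreover have "drop q (take p w @ drop p w) = drop q (take p w) @ drop p w"
      using 1 assms(4) by (simp del: append_take_drop_id)
    hence "drop q w = drop q (take p w) @ drop p w" by simp
    ultimately have d: "set (drop q ?w) = insert x (set (drop q w))"
      by auto
    have "y \<noteq> x" if "y < z" "subseq [y,z] (take q w)" for y z
      using that x by (auto dest!: set_subseq in_set_takeD)
    thus ?thesis
      using 1 assms(4) unfolding sites_def mem_Collect_eq site_2312_def t d len by auto
  next
    case 2
    have t: "take q ?w = take p w @ [x]"
      using 2 assms(4) by (auto simp: ins_split_def)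
    have d: "drop q ?w = drop p w @ replicate (a - 1) x"
      using 2 assms(4) by (auto simp: ins_split_def)
    have "site_2312 (take q ?w) (drop q ?w)"
      unfolding site_2312_def
    proof (intro allI impI notI)
      fix y z assume yz: "y < z" "subseq [y,z] (take q ?w)" "y \<in> set (drop q ?w)"
      hence "subseq [y,z] (take p w)"
        using assms(1) unfolding t by (auto simp: subseq_pair_append dest!: in_set_takeD split: if_splits)
      moreover from this have "y \<noteq> x"
        using x by (auto dest!: set_subseq in_set_takeD)
      ultimately show False using assms(3) yz unfolding d sites_def site_2312_def by auto
    qed
    thus ?thesis using 2 assms(2,4) len by (auto simp: sites_def)
  next
    case 3
    \<comment> \<open>This is the letter directly after the first \<open>x\<close> in the
      child.\<close>
    define y where "y = w ! p"
    have y: "x < y" using assms(1,4) by (simp add: y_def)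
    have "?w = (take p w @ [x,y]) @ (drop (Suc p) w @ replicate (a - 1) x)"
      using assms(4) by (simp add: ins_split_def y_def Cons_nth_drop_Suc)
    moreover have "subseq [x,y] (take p w @ [x,y])" by (rule subseq_drop_many) simp
    moreover have "length (take p w @ [x,y]) \<le> q" using 3(1) assms(4) by simp
    ultimately have "subseq [x,y] (take q ?w)" by (simp only: subseq_take_append)
    moreover have "last ?w \<in> set (drop q ?w)" using 3 len by (intro last_in_drop) simp
    moreover have "last ?w = x" using assms(2) by (simp add: ins_split_def last_append)
    ultimately show ?thesis using 3 assms(4) y unfolding sites_def site_2312_def by auto
  next
    case 4
    thus ?thesis using assms(2,4) len by (auto simp: sites_def site_2312_def)
  qed
qed

text \<open>Only the right factor matters. A cut after the block leaves a suffix of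
  \<open>w\<close>; a cut before the last copy leaves one harmless \<open>x\<close>; any earlier cut
  leaves \<open>x\<close> twice, followed by the larger last letter of \<open>w\<close>.\<close>

lemma sites_ins_block_1223:
  assumes "\<forall>y\<in>set w. x < y" "a \<ge> 2" "p \<in> sites site_1223 w" "p < length w"
  shows "sites site_1223 (ins_block x a (take p w) (drop p w)) =
    insert (p + a - 1) ((\<lambda>q. q + a) ` {q\<in>sites site_1223 w. p \<le> q})"
proof (rule set_eqI)
  fix q
  let ?w = "ins_block x a (take p w) (drop p w)"
  have len: "length ?w = length w + a" using assms(4) by (simp add: ins_block_def)
  have x: "x \<notin> set w" using assms(1) by auto
  consider "p + a \<le> q" | "q = p + a - 1" | "q < p + a - 1"
    by linarith
  thus "q \<in> sites site_1223 ?w \<longleftrightarrow>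
    q \<in> insert (p + a - 1) ((\<lambda>q. q + a) ` {q\<in>sites site_1223 w. p \<le> q})"
  proof cases
    case 1
    then obtain r where r: "q = r + a" "p \<le> r" by (metis add_le_cancel_right le_add_diff_inverse2 add_leD2)
    have "drop q ?w = drop r w" using r assms(4) by (simp add: ins_block_def)
    hence "q \<in> sites site_1223 ?w \<longleftrightarrow> r \<in> sites site_1223 w"
      using r len by (simp add: sites_def site_1223_def)
    thus ?thesis using r assms(2) by auto
  next
    case 2
    have "?w = (take p w @ replicate (a - 1) x) @ x # drop p w"
      using assms(2) by (cases a) (auto simp: ins_block_def replicate_append_same)
    hence d: "drop q ?w = x # drop p w" using 2 assms(2,4) by simp
    have "\<not> subseq [y,y,z] (drop q ?w)" if "y < z" for y z
      using that assms(3) x unfolding d sites_def site_1223_def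
      by (auto dest!: set_subseq in_set_dropD split: if_splits)
    thus ?thesis using 2 assms(2,4) len by (auto simp: sites_def site_1223_def)
  next
    case 3
    have "?w = (take p w @ replicate (a - 2) x) @ [x,x] @ drop p w"
    proof -
      obtain b where "a = Suc (Suc b)" using assms(2) by (metis add_2_eq_Suc le_Suc_ex)
      thus ?thesis by (simp add: ins_block_def replicate_app_Cons_same)
    qed
    hence "drop q ?w = drop q (take p w @ replicate (a - 2) x) @ [x,x] @ drop p w"
      using 3 assms(2,4) by simp
    moreover have "last w \<in> set (drop p w)" using assms(4) by (rule last_in_drop)
    ultimately have "subseq [x,x,last w] (drop q ?w)"
      by (auto intro!: subseq_drop_many simp: subseq_singleton_left)
    moreover have "x < last w" using assms(1,4) by (metis last_in_set length_0_conv not_less_zero)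
    ultimately have "q \<notin> sites site_1223 ?w" unfolding sites_def site_1223_def by auto
    thus ?thesis using 3 by auto
  qed
qed

section \<open>The three pairs of patterns as insertion schemes\<close>

interpretation av_112_2312: insertion_scheme
  "\<lambda>w. avoids_pattern w [1,1,2] \<and> avoids_pattern w [2,3,1,2]" site_2312 ins_split
proof
  fix u v :: "nat list" and x a :: nat
  assume less: "\<forall>y\<in>set u \<union> set v. x < y" and a: "a > 0"
  let ?w = "ins_split x a u v"
  have min: "\<forall>z\<in>set ?w. x \<le> z" using less by (auto simp: ins_split_def less_imp_le)
  have x: "x \<notin> set u" "x \<notin> set v" using less by auto
  have nx: "\<not> subseq q u" "\<not> subseq q v" if "x \<in> set q" for q
    using that x set_subseq by blast+
  have lower: "x < y" if "subseq [y,z] u" for y z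
    using set_subseq[OF that] less by auto
  \<comment> \<open>All copies after the first stand at the end, with nothing larger behind
    them.\<close>
  have "\<not> subseq [x,x,y] ?w" if "x < y" for y
    using that x unfolding ins_split_def subseq_triple_append subseq_pair_append
    by (auto simp: subseq_replicate_iff dest!: set_subseq split: if_splits)
  \<comment> \<open>For the same reason only the first copy can play the 1 of 2312, so 23 lies in
    \<open>u\<close> and the last 2 in \<open>v\<close>.\<close>
  moreover have "(\<forall>y>x. \<forall>z>y. \<not> subseq [y,z,x,y] ?w) \<longleftrightarrow> site_2312 u v"
    using x lower unfolding ins_split_def subseq_quadruple_append subseq_triple_append subseq_pair_append
      site_2312_def
    by (auto simp: subseq_replicate_iff subseq_singleton_left nx)
  ultimately show "(avoids_pattern ?w [1,1,2] \<and> avoids_pattern ?w [2,3,1,2]) \<longleftrightarrow>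
    (avoids_pattern (u @ v) [1,1,2] \<and> avoids_pattern (u @ v) [2,3,1,2]) \<and> site_2312 u v"
    unfolding avoids_112_min[OF min] avoids_2312_min[OF min] filter_ins_split[OF x] by blast
next
  fix u v :: "nat list" and x :: nat
  assume le: "\<forall>y\<in>set u \<union> set v. x \<le> y"
    and "\<not> subseq [x,x] (u @ v) \<or> (\<forall>y>x. \<not> subseq [x,y] (u @ v))"
  \<comment> \<open>Such a configuration would contain both \<open>[x,x]\<close> and
    \<open>[x,z]\<close>, against either alternative.\<close>
  hence no: "\<not> (subseq [x,z] u \<and> x \<in> set v)" if "x < z" for z
    using that set_subseq[of "[x,z]" u] unfolding subseq_pair_append by auto
  have mu: "\<forall>y\<in>set u. x \<le> y" and mv: "\<forall>y\<in>set v. x \<le> y" using le by auto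
  show "site_2312 u v \<longleftrightarrow> site_2312 (filter (\<lambda>y. y \<noteq> x) u) (filter (\<lambda>y. y \<noteq> x) v)"
  proof -
    have "subseq [y,z] u \<longleftrightarrow>
        subseq [y,z] (filter (\<lambda>y. y \<noteq> x) u) \<or> y = x \<and> subseq [x,z] u" if "y < z" for y z
      using subseq_min_cases[OF mu, of "[y,z]"] that by auto
    moreover have "y \<noteq> x" if "subseq [y,z] (filter (\<lambda>y. y \<noteq> x) u)" for y z
      using set_subseq[OF that] by auto
    ultimately show ?thesis unfolding site_2312_def set_filter mem_Collect_eq using no by blast
  qed
next
  fix w :: "nat list" and x a :: nat
  assume "\<forall>y\<in>set w. x < y" "a \<ge> 2"
  thus "bij_betw (\<lambda>p. card (sites site_2312 (ins_split x a (take p w) (drop p w))))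
    (sites site_2312 w - {length w}) {3..card (sites site_2312 w) + 1}"
    by (intro inner_ranks_low[of _ _ _ a] sites_ins_split_2312)
      (auto simp: sites_def site_2312_def)
qed (use split_decompose filter_ins_split in
  \<open>auto simp: avoids_Nil site_2312_def ins_split_def gr0_conv_Suc\<close>)

interpretation av_121_1223: insertion_scheme
  "\<lambda>w. avoids_pattern w [1,2,1] \<and> avoids_pattern w [1,2,2,3]" site_1223 ins_block
proof
  fix u v :: "nat list" and x a :: nat
  assume less: "\<forall>y\<in>set u \<union> set v. x < y" and a: "a > 0"
  let ?w = "ins_block x a u v"
  have min: "\<forall>z\<in>set ?w. x \<le> z" using less by (auto simp: ins_block_def less_imp_le)
  have x: "x \<notin> set u" "x \<notin> set v" using less by auto
  have nx: "\<not> subseq q u" "\<not> subseq q v" if "x \<in> set q" for q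
    using that x set_subseq by blast+
  have lower: "x < y" if "subseq [y,y,z] v" for y z
    using set_subseq[OF that] less by auto
  have "\<not> subseq [x,y,x] ?w" if "x < y" for y
    using that x unfolding ins_block_def subseq_triple_append subseq_pair_append
    by (auto simp: subseq_replicate_iff dest!: set_subseq split: if_splits)
  \<comment> \<open>Letters above \<open>x\<close> that follow a copy of \<open>x\<close> all lie in
    \<open>v\<close>, so the 223 must be found there.\<close>
  moreover have "(\<forall>y>x. \<forall>z>y. \<not> subseq [x,y,y,z] ?w) \<longleftrightarrow> site_1223 u v"
    using a x lower unfolding ins_block_def subseq_quadruple_append subseq_triple_append subseq_pair_append
      site_1223_def
    by (auto simp: subseq_replicate_iff subseq_singleton_left nx)
  ultimately show "(avoids_pattern ?w [1,2,1] \<and> avoids_pattern ?w [1,2,2,3]) \<longleftrightarrow>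
    (avoids_pattern (u @ v) [1,2,1] \<and> avoids_pattern (u @ v) [1,2,2,3]) \<and> site_1223 u v"
    unfolding avoids_121_min[OF min] avoids_1223_min[OF min] filter_ins_block[OF x] by blast
next
  fix u v :: "nat list" and x :: nat
  assume le: "\<forall>y\<in>set u \<union> set v. x \<le> y"
    and nn: "\<not> subseq [x,x] (u @ v) \<or> (\<forall>y>x. \<not> subseq [x,y] (u @ v))"
  \<comment> \<open>An occurrence of \<open>[x,x,z]\<close> contains both \<open>[x,x]\<close> and
    \<open>[x,z]\<close>, which contradicts \<open>nn\<close> in either case.\<close>
  have no: "\<not> subseq [x,x,z] v" if "x < z" for z
  proof
    assume "subseq [x,x,z] v"
    moreover from this have "subseq [x,z] v" by (rule subseq_Cons')
    moreover have "subseq [x,x] [x,x,z]" by simp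
    ultimately have "subseq [x,x] v" "subseq [x,z] v"
      by (blast intro: subseq_order.order_trans)+
    thus False using nn that by (auto intro: subseq_drop_many)
  qed
  have mv: "\<forall>y\<in>set v. x \<le> y" using le by auto
  show "site_1223 u v \<longleftrightarrow> site_1223 (filter (\<lambda>y. y \<noteq> x) u) (filter (\<lambda>y. y \<noteq> x) v)"
  proof -
    have "subseq [y,y,z] v \<longleftrightarrow>
        subseq [y,y,z] (filter (\<lambda>y. y \<noteq> x) v) \<or> y = x \<and> subseq [x,x,z] v" if "y < z" for y z
      using subseq_min_cases[OF mv, of "[y,y,z]"] that by auto
    thus ?thesis unfolding site_1223_def using no by blast
  qed
next
  fix w :: "nat list" and x a :: nat
  assume "\<forall>y\<in>set w. x < y" "a \<ge> 2"
  thus "bij_betw (\<lambda>p. card (sites site_1223 (ins_block x a (take p w) (drop p w))))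
    (sites site_1223 w - {length w}) {3..card (sites site_1223 w) + 1}"
    by (intro inner_ranks_high[of _ _ _ a] sites_ins_block_1223)
      (auto simp: sites_def site_1223_def)
qed (use block_decompose filter_ins_block in
  \<open>auto simp: avoids_Nil site_1223_def ins_block_def gr0_conv_Suc\<close>)

interpretation av_121_2213: insertion_scheme
  "\<lambda>w. avoids_pattern w [1,2,1] \<and> avoids_pattern w [2,2,1,3]" site_2213 ins_block
proof
  fix u v :: "nat list" and x a :: nat
  assume less: "\<forall>y\<in>set u \<union> set v. x < y" and a: "a > 0"
  let ?w = "ins_block x a u v"
  have min: "\<forall>z\<in>set ?w. x \<le> z" using less by (auto simp: ins_block_def less_imp_le)
  have x: "x \<notin> set u" "x \<notin> set v" using less by auto
  have nx: "\<not> subseq q u" "\<not> subseq q v" if "x \<in> set q" for q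
    using that x set_subseq by blast+
  have lower: "x < y" if "subseq [y,y] u" for y
    using set_subseq[OF that] less by auto
  have "\<not> subseq [x,y,x] ?w" if "x < y" for y
    using that x unfolding ins_block_def subseq_triple_append subseq_pair_append
    by (auto simp: subseq_replicate_iff dest!: set_subseq split: if_splits)
  \<comment> \<open>The block separates \<open>u\<close> from \<open>v\<close>: the 22 before a copy
    of \<open>x\<close> lies in \<open>u\<close>, the 3 after it in \<open>v\<close>.\<close>
  moreover have "(\<forall>y>x. \<forall>z>y. \<not> subseq [y,y,x,z] ?w) \<longleftrightarrow> site_2213 u v"
    using a x lower unfolding ins_block_def subseq_quadruple_append subseq_triple_append subseq_pair_append
      site_2213_def
    by (auto simp: subseq_replicate_iff subseq_singleton_left nx)
  ultimately show "(avoids_pattern ?w [1,2,1] \<and> avoids_pattern ?w [2,2,1,3]) \<longleftrightarrow>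
    (avoids_pattern (u @ v) [1,2,1] \<and> avoids_pattern (u @ v) [2,2,1,3]) \<and> site_2213 u v"
    unfolding avoids_121_min[OF min] avoids_2213_min[OF min] filter_ins_block[OF x] by blast
next
  fix u v :: "nat list" and x :: nat
  assume le: "\<forall>y\<in>set u \<union> set v. x \<le> y"
    and "\<not> subseq [x,x] (u @ v) \<or> (\<forall>y>x. \<not> subseq [x,y] (u @ v))"
  hence no: "\<not> (subseq [x,x] u \<and> z \<in> set v)" if "x < z" for z
    using that set_subseq[of "[x,x]" u] unfolding subseq_pair_append by auto
  have mu: "\<forall>y\<in>set u. x \<le> y" and mv: "\<forall>y\<in>set v. x \<le> y" using le by auto
  show "site_2213 u v \<longleftrightarrow> site_2213 (filter (\<lambda>y. y \<noteq> x) u) (filter (\<lambda>y. y \<noteq> x) v)"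
  proof -
    have "subseq [y,y] u \<longleftrightarrow>
        subseq [y,y] (filter (\<lambda>y. y \<noteq> x) u) \<or> y = x \<and> subseq [x,x] u" for y
      using subseq_min_cases[OF mu, of "[y,y]"] by auto
    \<comment> \<open>Since \<open>z > y\<close> and \<open>y\<close> is at least \<open>x\<close>,
      deleting \<open>x\<close> from the right factor removes no candidate for
      \<open>z\<close>.\<close>
    moreover have "z \<noteq> x" if "subseq [y,y] u" "y < z" for y z
      using set_subseq[OF that(1)] that(2) mu by auto
    ultimately show ?thesis unfolding site_2213_def set_filter mem_Collect_eq using no by blast
  qed
next
  fix w :: "nat list" and x a :: nat
  assume "\<forall>y\<in>set w. x < y" "a \<ge> 2"
  thus "bij_betw (\<lambda>p. card (sites site_2213 (ins_block x a (take p w) (drop p w))))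
    (sites site_2213 w - {length w}) {3..card (sites site_2213 w) + 1}"
    by (intro inner_ranks_low[of _ _ _ a] sites_ins_block_2213)
      (auto simp: sites_def site_2213_def)
qed (use block_decompose filter_ins_block in
  \<open>auto simp: avoids_Nil site_2213_def ins_block_def gr0_conv_Suc\<close>)

theorem theorem2p14:
  shows "m_equivalent {[1,1,2], [2,3,1,2]} {[1,2,1], [1,2,2,3]} \<and>
         m_equivalent {[1,2,1], [1,2,2,3]} {[1,2,1], [2,2,1,3]} \<and>
         m_equivalent {[1,1,2], [2,3,1,2]} {[1,2,1], [2,2,1,3]}"
  unfolding m_equivalent_def av_def ball_simps
  \<comment> \<open>All three counts equal the same \<open>tree_sum\<close> of the multiplicities of
    \<open>S\<close>.\<close>
  using av_112_2312.card_good_permutations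
    av_121_1223.card_good_permutations
    av_121_2213.card_good_permutations
  by simp

end
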